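(* Let $f,g\in \mathrm{LC}_g(\mathbb{R}^n)$. Then $$\frac{\int f^{2}(x)\,dx}{\|f*g_-\|_{\infty}}\le N(f,g)\le2^{n}\,\frac{\int f^{2}(x)\,dx}{\|f*g\|_{\infty}}.$$ In the special case where $f,g$ are even functions, $$\frac{\int f^{2}(x)\,dx}{\int f(x)g(x)\,dx}\le N(f,g)\le2^{n}\,\frac{\int f^{2}(x)\,dx}{\int f(x)g(x)\,dx}.$$
   Context: $\mathrm{LC}_g(\mathbb{R}^n)$ is the class of geometric log-concave functions: upper semi-continuous $f:\mathbb{R}^n\to[0,1]$ with $-\log f$ convex (values in $[0,\infty]$), $\max f=f(0)=1$, and $0<\int f<\infty$. $u_-(x)=u(-x)$; $f*g$ is the usual convolution $(f*g)(x)=\int f(t)g(x-t)\,dt$ and $\|\cdot\|_\infty$ the supremum norm. The functional covering number is $N(f,g)=\inf\{\mu(\mathbb{R}^n)\}$ over all non-negative Borel measures $\mu$ on $\mathbb{R}^n$ such that $(\mu*g)(x)=\int g(x-t)\,d\mu(t)\ge f(x)$ for all $x\in\mathbb{R}^n$. *)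

theory Defs
  imports "HOL-Analysis.Analysis"
begin

definition upper_semicontinuous :: "('a::topological_space \<Rightarrow> real) \<Rightarrow> bool" where
  "upper_semicontinuous f \<longleftrightarrow> (\<forall>x. \<forall>c>f x. eventually (\<lambda>y. f y < c) (nhds x))"

text \<open>\<open>-log f\<close> with values in \<open>(-\<infinity>, \<infinity>]\<close>, where \<open>-log 0 = \<infinity>\<close>; meant for \<open>f \<ge> 0\<close>.\<close>

definition neg_log :: "('a \<Rightarrow> real) \<Rightarrow> 'a \<Rightarrow> ereal" where
  "neg_log f x = (if f x = 0 then \<infinity> else ereal (- ln (f x)))"

text \<open>Convexity of an extended-real-valued function, in the format of \<open>convex_on UNIV\<close>
  (which is only available for real-valued functions).  It is used below for functions that do not
  take the value \<open>-\<infinity>\<close>; the library convention \<open>0 * \<infinity> = 0\<close> makes the inequality trivial for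
  \<open>u = 0\<close> or \<open>v = 0\<close>.\<close>

definition ereal_convex :: "('a::real_vector \<Rightarrow> ereal) \<Rightarrow> bool" where
  "ereal_convex \<phi> \<longleftrightarrow>
     (\<forall>x y. \<forall>u\<ge>0. \<forall>v\<ge>0. u + v = 1 \<longrightarrow>
        \<phi> (u *\<^sub>R x + v *\<^sub>R y) \<le> ereal u * \<phi> x + ereal v * \<phi> y)"

definition LC_g :: "(real ^ 'n \<Rightarrow> real) set" where
  "LC_g = {f. (\<forall>x. 0 \<le> f x \<and> f x \<le> 1) \<and> upper_semicontinuous f \<and> ereal_convex (neg_log f) \<and>
              (\<forall>x. f x \<le> f 0) \<and> f 0 = 1 \<and>
              0 < (\<integral>\<^sup>+x. ennreal (f x) \<partial>lborel) \<and> (\<integral>\<^sup>+x. ennreal (f x) \<partial>lborel) < \<infinity>}"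

definition reflect :: "('a::uminus \<Rightarrow> real) \<Rightarrow> 'a \<Rightarrow> real" where
  "reflect u = (\<lambda>x. u (- x))"

definition even_fun :: "('a::uminus \<Rightarrow> real) \<Rightarrow> bool" where
  "even_fun f \<longleftrightarrow> (\<forall>x. f (- x) = f x)"

text \<open>All functions below are non-negative, so integrals are Lebesgue integrals with values in
  \<open>[0, \<infinity>]\<close>, the supremum norm is a plain supremum, and no integrability or boundedness side
  conditions are needed for these expressions to be meaningful.\<close>

definition fconv :: "(real ^ 'n \<Rightarrow> real) \<Rightarrow> (real ^ 'n \<Rightarrow> real) \<Rightarrow> real ^ 'n \<Rightarrow> ennreal" where
  "fconv f g x = (\<integral>\<^sup>+t. ennreal (f t * g (x - t)) \<partial>lborel)"

definition sup_norm :: "('a \<Rightarrow> ennreal) \<Rightarrow> ennreal" where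
  "sup_norm h = (SUP x. h x)"

definition mconv :: "(real ^ 'n) measure \<Rightarrow> (real ^ 'n \<Rightarrow> real) \<Rightarrow> real ^ 'n \<Rightarrow> ennreal" where
  "mconv \<mu> g x = (\<integral>\<^sup>+t. ennreal (g (x - t)) \<partial>\<mu>)"

definition covering_number :: "(real ^ 'n \<Rightarrow> real) \<Rightarrow> (real ^ 'n \<Rightarrow> real) \<Rightarrow> ennreal" where
  "covering_number f g =
     Inf {emeasure \<mu> UNIV | \<mu>. sets \<mu> = sets borel \<and> (\<forall>x. ennreal (f x) \<le> mconv \<mu> g x)}"

end

theory Submission
  imports Defs
begin

text \<open>If \<open>\<mu> * g \<ge> f\<close>, then integrating against \<open>f\<close> gives
  \<open>\<integral> f\<^sup>2 \<le> \<integral> (f * g\<^sub>-) d\<mu> \<le> \<parallel>f * g\<^sub>-\<parallel> \<mu>(UNIV)\<close>, the lower bound.  For the upper bound, the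
  measure with density \<open>f((t + a) / 2)\<^sup>2 / (f * g)(a)\<close> in \<open>t\<close> covers \<open>f\<close>, since
  \<open>f((t + a) / 2)\<^sup>2 \<ge> f(x) f(t + a - x)\<close> by log-concavity; its mass is \<open>2\<^sup>n \<integral> f\<^sup>2 / (f * g)(a)\<close>,
  and \<open>a\<close> is arbitrary.  For even \<open>f\<close> and \<open>g\<close> the convolution is even, and the midpoint
  Prekopa-Leindler inequality gives \<open>(f * g)(x) (f * g)(-x) \<le> (f * g)(0)\<^sup>2\<close>, so its supremum is
  \<open>\<integral> f g\<close>.\<close>

section \<open>The Brunn-Minkowski inequality for midpoints on the real line\<close>

text \<open>The set on the right consists of the midpoints of \<open>b\<close> with the points of
  \<open>A\<close>. It is used with \<open>b\<close> taken from the second set of the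
  Brunn-Minkowski inequality, and with the roles exchanged.\<close>

lemma emeasure_lborel_halve:
  fixes A :: "real set"
  assumes [measurable]: "A \<in> sets borel"
  shows "emeasure lborel A = 2 * emeasure lborel {z. 2 * z - b \<in> A}"
proof -
  have "emeasure lborel A = (\<integral>\<^sup>+z. indicator A z \<partial>lborel)"
    by simp
  also have "\<dots> = ennreal \<bar>2\<bar> * (\<integral>\<^sup>+z. indicator A (- b + 2 * z) \<partial>lborel)"
    by (rule nn_integral_real_affine) auto
  also have "(\<integral>\<^sup>+z. indicator A (- b + 2 * z) \<partial>lborel) = (\<integral>\<^sup>+z. indicator {z. 2 * z - b \<in> A} z \<partial>lborel)"
    by (intro nn_integral_cong) (auto simp: indicator_def algebra_simps)
  also have "\<dots> = emeasure lborel {z. 2 * z - b \<in> A}"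
    by (rule nn_integral_indicator) measurable
  finally show ?thesis by simp
qed

text \<open>The running maxima of an enumeration of a countable dense subset of \<open>A\<close>
  stay in \<open>A\<close> and pass every point of \<open>A\<close> except a greatest one, which has
  measure zero. Unbounded \<open>A\<close> needs no separate case.\<close>

lemma emeasure_lborel_cofinal_seq:
  fixes A :: "real set"
  assumes A[measurable]: "A \<in> sets borel" and "A \<noteq> {}"
  obtains a :: "nat \<Rightarrow> real" where "\<And>n. a n \<in> A" "incseq a"
    "(SUP n. emeasure lborel (A \<inter> {..<a n})) = emeasure lborel A"
proof -
  obtain T where T: "countable T" "T \<subseteq> A" "A \<subseteq> closure T"
    using separable by blast
  with \<open>A \<noteq> {}\<close> have "T \<noteq> {}" by auto
  define a where "a n = Max (from_nat_into T ` {..n})" for n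
  have aT: "a n \<in> T" for n
  proof -
    have "a n \<in> from_nat_into T ` {..n}"
      unfolding a_def by (rule Max_in) auto
    then show ?thesis using from_nat_into[OF \<open>T \<noteq> {}\<close>] by auto
  qed
  have inc: "incseq a"
    unfolding a_def by (intro incseq_SucI Max_mono) auto
  \<comment> \<open>The greatest element of \<open>A\<close>, if there is one; otherwise
    \<open>M\<close> is empty.\<close>
  define M where "M = {m\<in>A. \<forall>x\<in>A. x \<le> m}"
  have "M \<subseteq> {m}" if "m \<in> M" for m
    using that by (force simp: M_def)
  then have M: "finite M"
    by (metis finite.emptyI finite_insert finite_subset ex_in_conv)
  have Mb: "M \<in> sets borel"
    using M by (intro borel_closed finite_imp_closed)
  have sub: "A - M \<subseteq> (\<Union>n. A \<inter> {..<a n})"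
  proof
    fix x assume x: "x \<in> A - M"
    then obtain y where y: "y \<in> A" "x < y" by (auto simp: M_def not_le)
    then have "y \<in> closure T" using T by auto
    \<comment> \<open>The ray \<open>{x<..}\<close> is an open neighbourhood of \<open>y\<close>,
      which lies in the closure of \<open>T\<close>.\<close>
    then have "T \<inter> {x<..} \<noteq> {}"
      using y closure_iff_nhds_not_empty[of y T] by (metis greaterThan_iff open_greaterThan order_refl)
    then obtain d where d: "d \<in> T" "x < d" by auto
    then obtain n where n: "from_nat_into T n = d"
      using from_nat_into_surj[OF T(1)] by metis
    have "d \<le> a n" unfolding a_def by (rule Max_ge) (use n in auto)
    then show "x \<in> (\<Union>n. A \<inter> {..<a n})" using d x by (intro UN_I[of n]) auto
  qed
  have "(SUP n. emeasure lborel (A \<inter> {..<a n})) = emeasure lborel (\<Union>n. A \<inter> {..<a n})"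
    using inc by (intro SUP_emeasure_incseq) (auto simp: incseq_def intro: less_le_trans)
  also have "\<dots> = emeasure lborel A"
  proof (rule antisym)
    have "emeasure lborel A \<le> emeasure lborel ((\<Union>n. A \<inter> {..<a n}) \<union> M)"
      by (rule emeasure_mono) (use sub Mb in auto)
    also have "\<dots> \<le> emeasure lborel (\<Union>n. A \<inter> {..<a n}) + emeasure lborel M"
      by (rule emeasure_subadditive) (use Mb in auto)
    also have "emeasure lborel M = 0"
      using M by (simp add: emeasure_lborel_countable countable_finite)
    finally show "emeasure lborel A \<le> emeasure lborel (\<Union>n. A \<inter> {..<a n})" by simp
  qed (auto intro!: emeasure_mono)
  finally show ?thesis using that aT T inc by blast
qed

text \<open>For \<open>a \<in> A\<close> and \<open>b \<in> B\<close>, the translates \<open>A \<inter> {..<a} + b\<close> and \<open>a + B \<inter> {b..}\<close> are disjoint, and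
  letting \<open>a\<close> run to the top of \<open>A\<close> and \<open>b\<close> to the bottom of \<open>B\<close> exhausts both sets up to one
  point.  This avoids approximation by compact sets.\<close>

lemma brunn_minkowski_real:
  fixes A B C :: "real set"
  assumes A[measurable]: "A \<in> sets borel" and B[measurable]: "B \<in> sets borel"
    and C[measurable]: "C \<in> sets borel"
    and "A \<noteq> {}" "B \<noteq> {}" and mid: "\<And>x y. x \<in> A \<Longrightarrow> y \<in> B \<Longrightarrow> (x + y) / 2 \<in> C"
  shows "emeasure lborel A + emeasure lborel B \<le> 2 * emeasure lborel C"
proof -
  obtain a where a: "\<And>n. a n \<in> A" "incseq a"
    "(SUP n. emeasure lborel (A \<inter> {..<a n})) = emeasure lborel A"
    using emeasure_lborel_cofinal_seq[OF A \<open>A \<noteq> {}\<close>] by blast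
  have lt: "emeasure lborel (A \<inter> {..<a n}) + emeasure lborel (B \<inter> {b..}) \<le> 2 * emeasure lborel C"
    if "b \<in> B" for n b
  proof -
    have "emeasure lborel (A \<inter> {..<a n}) + emeasure lborel (B \<inter> {b..}) =
        2 * (emeasure lborel {z. 2 * z - b \<in> A \<inter> {..<a n}} + emeasure lborel {z. 2 * z - a n \<in> B \<inter> {b..}})"
      using emeasure_lborel_halve[of "A \<inter> {..<a n}" b] emeasure_lborel_halve[of "B \<inter> {b..}" "a n"]
      by (simp add: distrib_left)
    \<comment> \<open>Disjointness: points of the first set satisfy \<open>2 * z < a n + b\<close>,
      points of the second \<open>2 * z \<ge> a n + b\<close>. This is why one ray is open and the
      other closed.\<close>
    also have "emeasure lborel {z. 2 * z - b \<in> A \<inter> {..<a n}} + emeasure lborel {z. 2 * z - a n \<in> B \<inter> {b..}}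
        = emeasure lborel ({z. 2 * z - b \<in> A \<inter> {..<a n}} \<union> {z. 2 * z - a n \<in> B \<inter> {b..}})"
      by (rule plus_emeasure) auto
    also have "\<dots> \<le> emeasure lborel C"
      using mid[of _ b] mid[of "a n"] that a by (intro emeasure_mono) (auto, force+)
    finally show ?thesis by (simp add: mult_left_mono)
  qed
  \<comment> \<open>Reflection turns the descent to the bottom of \<open>B\<close> into an ascent to
    the top of \<open>B'\<close>, so the same lemma supplies the second sequence.\<close>
  define B' where "B' = uminus ` B"
  have B'eq: "B' = uminus -` B" by (auto simp: B'_def) (metis add.inverse_inverse imageI)
  have B': "B' \<in> sets borel" "B' \<noteq> {}"
    unfolding B'eq using measurable_sets[OF borel_measurable_uminus[OF measurable_ident] B]
    using \<open>B \<noteq> {}\<close> by (auto simp: B'eq[symmetric] B'_def)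
  obtain b where b: "\<And>n. b n \<in> B'" "incseq b"
    "(SUP n. emeasure lborel (B' \<inter> {..<b n})) = emeasure lborel B'"
    using emeasure_lborel_cofinal_seq[OF B'] by blast
  have refl: "emeasure lborel (uminus -` X) = emeasure lborel X" if "X \<in> sets borel" for X :: "real set"
    by (subst lborel_distr_uminus[symmetric], subst emeasure_distr) (use that in auto)
  have eqB: "emeasure lborel (B' \<inter> {..<b n}) = emeasure lborel (B \<inter> {- b n<..})" for n
  proof -
    have "B' \<inter> {..<b n} = uminus -` (B \<inter> {- b n<..})" by (auto simp: B'eq)
    then show ?thesis by (simp only:) (rule refl, simp)
  qed
  have "emeasure lborel A + emeasure lborel B = (SUP n. emeasure lborel (A \<inter> {..<a n})) + (SUP n. emeasure lborel (B' \<inter> {..<b n}))"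
    using a b refl[OF B] by (simp add: B'eq)
  also have "\<dots> = (SUP n. emeasure lborel (A \<inter> {..<a n}) + emeasure lborel (B' \<inter> {..<b n}))"
    using a(2) b(2) B'(1)
    by (intro ennreal_SUP_add[symmetric]) (auto simp: incseq_def intro!: emeasure_mono intro: less_le_trans)
  also have "\<dots> \<le> 2 * emeasure lborel C"
  proof (rule SUP_least)
    fix n
    have "- b n \<in> B" using b(1)[of n] by (auto simp: B'_def)
    then have "emeasure lborel (A \<inter> {..<a n}) + emeasure lborel (B \<inter> {- b n..}) \<le> 2 * emeasure lborel C"
      by (rule lt)
    moreover have "emeasure lborel (B \<inter> {- b n<..}) \<le> emeasure lborel (B \<inter> {- b n..})"
      by (rule emeasure_mono) auto
    ultimately show "emeasure lborel (A \<inter> {..<a n}) + emeasure lborel (B' \<inter> {..<b n}) \<le> 2 * emeasure lborel C"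
      unfolding eqB by (meson add_left_mono order_trans)
  qed
  finally show ?thesis .
qed

section \<open>The Prekopa-Leindler inequality for midpoints on the real line\<close>

text \<open>Write \<open>f x\<close> as the length of the interval of levels \<open>t\<close> with
  \<open>0 < t < f x\<close> and exchange the integrals. Since \<open>f \<le> 1\<close>, levels in
  \<open>{0<..<1}\<close> suffice.\<close>

lemma layer_cake_le_1:
  fixes f :: "real \<Rightarrow> ennreal"
  assumes [measurable]: "f \<in> borel_measurable borel" and le: "\<And>x. f x \<le> 1"
  shows "(\<integral>\<^sup>+x. f x \<partial>lborel) = (\<integral>\<^sup>+t. indicator {0<..<1} t * emeasure lborel {x. ennreal t < f x} \<partial>lborel)"
proof -
  have "f x = (\<integral>\<^sup>+t. indicator {0<..<1} t * indicator {x. ennreal t < f x} x \<partial>lborel)" for x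
  proof -
    obtain r where r: "f x = ennreal r" "0 \<le> r" "r \<le> 1"
      using le[of x] by (cases "f x") (auto simp: top_unique)
    have "(\<integral>\<^sup>+t. indicator {0<..<1} t * indicator {x. ennreal t < f x} x \<partial>lborel) =
        (\<integral>\<^sup>+t. indicator {0<..<r} t \<partial>lborel)"
      using r by (intro nn_integral_cong) (auto simp: indicator_def ennreal_less_iff)
    then show ?thesis using r by simp
  qed
  then have "(\<integral>\<^sup>+x. f x \<partial>lborel) =
      (\<integral>\<^sup>+x. (\<integral>\<^sup>+t. indicator {0<..<1} t * indicator {x. ennreal t < f x} x \<partial>lborel) \<partial>lborel)"
    by (rule nn_integral_cong)
  also have "\<dots> = (\<integral>\<^sup>+t. (\<integral>\<^sup>+x. indicator {0<..<1} t * indicator {x. ennreal t < f x} x \<partial>lborel) \<partial>lborel)"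
    by (rule lborel_pair.Fubini') (simp add: indicator_def case_prod_beta')
  also have "\<dots> = (\<integral>\<^sup>+t. indicator {0<..<1} t * emeasure lborel {x. ennreal t < f x} \<partial>lborel)"
    by (simp add: nn_integral_cmult)
  finally show ?thesis .
qed

lemma ennreal_mult_strict_mono:
  fixes a b c d :: ennreal
  assumes "a < c" "b < d"
  shows "a * b < c * d"
proof (cases "c * d = top")
  case True
  have "a < top" "b < top"
    using assms by (auto intro: less_le_trans[OF _ top_greatest])
  then show ?thesis by (simp add: True ennreal_mult_less_top)
next
  case False
  have "0 < c" "0 < d" using assms by (auto intro: le_less_trans[of 0])
  with False have "c < top" "d < top" by (auto simp: ennreal_mult_eq_top_iff less_top)
  have "a * b \<le> a * d" using assms by (simp add: mult_left_mono)
  also have "a * d < c * d"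
    using assms(1) \<open>0 < d\<close> \<open>d < top\<close> by (rule ennreal_mult_strict_right_mono)
  finally show ?thesis .
qed

lemma ennreal_square_less_imp_less:
  fixes a b :: ennreal
  assumes "a * a < b * b"
  shows "a < b"
proof (rule ccontr)
  assume "\<not> a < b"
  then have "b * b \<le> a * a" by (intro mult_mono) auto
  with assms show False by simp
qed

text \<open>With both suprema equal to 1, the superlevel sets of \<open>f\<close> and
  \<open>g\<close> are non-empty at every level below 1, so Brunn-Minkowski applies level by level.
  Integrating over the levels bounds the sum of the integrals, which is stronger than bounding their
  product.\<close>

lemma prekopa_leindler_real_normalized:
  fixes f g h :: "real \<Rightarrow> ennreal"
  assumes f[measurable]: "f \<in> borel_measurable borel" and g[measurable]: "g \<in> borel_measurable borel"
    and h[measurable]: "h \<in> borel_measurable borel"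
    and mid: "\<And>x y. f x * g y \<le> (h ((x + y) / 2))\<^sup>2"
    and sf: "(SUP x. f x) = 1" and sg: "(SUP x. g x) = 1"
  shows "(\<integral>\<^sup>+x. f x \<partial>lborel) + (\<integral>\<^sup>+x. g x \<partial>lborel) \<le> 2 * (\<integral>\<^sup>+x. h x \<partial>lborel)"
proof -
  \<comment> \<open>Truncation makes the layer-cake formula on \<open>{0<..<1}\<close> available for
    \<open>h\<close> and leaves its superlevel sets at levels below 1 unchanged.\<close>
  define k where "k x = min 1 (h x)" for x
  have k[measurable]: "k \<in> borel_measurable borel" unfolding k_def by measurable
  let ?L = "\<lambda>u t. indicator {0<..<1} t * emeasure lborel {x. ennreal t < u x} :: ennreal"
  have fg: "f x \<le> 1" "g x \<le> 1" for x
    using SUP_upper[of x UNIV f] SUP_upper[of x UNIV g] sf sg by auto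
  have meas: "(\<lambda>t. ?L u t) \<in> borel_measurable lborel" if [measurable]: "u \<in> borel_measurable borel" for u :: "real \<Rightarrow> ennreal"
  proof -
    have "(\<lambda>(t, x). indicator {x. ennreal t < u x} x :: ennreal) \<in> borel_measurable (lborel \<Otimes>\<^sub>M lborel)"
      by (simp add: indicator_def case_prod_beta')
    then have "(\<lambda>t. \<integral>\<^sup>+x. indicator {x. ennreal t < u x} x \<partial>lborel) \<in> borel_measurable lborel"
      by (rule lborel.borel_measurable_nn_integral)
    then show ?thesis by simp
  qed
  have key: "?L f t + ?L g t \<le> 2 * ?L k t" for t
  proof (cases "0 < t \<and> t < 1")
    case True
    have "emeasure lborel {x. ennreal t < f x} + emeasure lborel {x. ennreal t < g x} \<le> 2 * emeasure lborel {x. ennreal t < k x}"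
    proof (rule brunn_minkowski_real)
      have "ennreal t < (SUP x. f x)" "ennreal t < (SUP x. g x)"
        using True by (auto simp: sf sg)
      then show "{x. ennreal t < f x} \<noteq> {}" "{x. ennreal t < g x} \<noteq> {}"
        by (auto simp: less_SUP_iff)
      fix x y assume "x \<in> {x. ennreal t < f x}" "y \<in> {x. ennreal t < g x}"
      then have "ennreal t < f x" "ennreal t < g y" by auto
      \<comment> \<open>Strictness has to survive the product, so that the midpoint lands in the
        strict superlevel set of \<open>h\<close>.\<close>
      then have "ennreal t * ennreal t < f x * g y" by (rule ennreal_mult_strict_mono)
      also have "\<dots> \<le> (h ((x + y) / 2))\<^sup>2" by (rule mid)
      finally have "ennreal t < h ((x + y) / 2)"
        unfolding power2_eq_square by (rule ennreal_square_less_imp_less)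
      then show "(x + y) / 2 \<in> {x. ennreal t < k x}"
        using True by (auto simp: k_def not_le)
    qed auto
    then show ?thesis using True by simp
  qed auto
  have "(\<integral>\<^sup>+x. f x \<partial>lborel) + (\<integral>\<^sup>+x. g x \<partial>lborel) = (\<integral>\<^sup>+t. ?L f t + ?L g t \<partial>lborel)"
    by (subst (1 2) layer_cake_le_1) (use fg meas in \<open>auto simp: nn_integral_add\<close>)
  also have "\<dots> \<le> (\<integral>\<^sup>+t. 2 * ?L k t \<partial>lborel)"
    by (intro nn_integral_mono key)
  also have "\<dots> = 2 * (\<integral>\<^sup>+t. ?L k t \<partial>lborel)"
    using meas by (intro nn_integral_cmult) auto
  also have "(\<integral>\<^sup>+t. ?L k t \<partial>lborel) = (\<integral>\<^sup>+x. k x \<partial>lborel)"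
    by (rule layer_cake_le_1[symmetric]) (auto simp: k_def)
  also have "\<dots> \<le> (\<integral>\<^sup>+x. h x \<partial>lborel)"
    by (intro nn_integral_mono) (auto simp: k_def)
  finally show ?thesis by (simp add: mult_left_mono)
qed

text \<open>Passes from the additive to the multiplicative form of Prekopa-Leindler, by
  \<open>(p - q)^2 \<ge> 0\<close> on finite values.\<close>

lemma ennreal_am_gm:
  fixes p q r :: ennreal
  assumes "p + q \<le> 2 * r"
  shows "p * q \<le> r\<^sup>2"
proof (cases "r = top")
  case False
  then obtain r' where r: "r = ennreal r'" "0 \<le> r'" by (cases r) auto
  from assms r have "p \<noteq> top" "q \<noteq> top" by (auto simp: top_unique ennreal_mult_eq_top_iff)
  then obtain p' q' where pq: "p = ennreal p'" "0 \<le> p'" "q = ennreal q'" "0 \<le> q'"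
    by (metis ennreal_cases)
  have "ennreal (p' + q') \<le> ennreal (2 * r')"
    using assms r pq by (simp add: ennreal_mult)
  then have "p' + q' \<le> 2 * r'" using r by (simp add: ennreal_le_iff)
  then have "(p' + q')\<^sup>2 \<le> (2 * r')\<^sup>2" using pq by (intro power_mono) auto
  moreover have "4 * (p' * q') \<le> (p' + q')\<^sup>2"
    using zero_le_power2[of "p' - q'"] by (simp add: power2_eq_square algebra_simps)
  ultimately have "p' * q' \<le> r'\<^sup>2" by (simp add: power2_eq_square)
  then show ?thesis using r pq by (simp add: ennreal_mult[symmetric] ennreal_power ennreal_leI)
qed (simp add: power2_eq_square)

text \<open>Homogeneity reduces finite positive suprema to suprema equal to 1; a zero supremum makes
  the left side vanish.\<close>

lemma prekopa_leindler_real_bounded: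
  fixes f g h :: "real \<Rightarrow> ennreal"
  assumes f[measurable]: "f \<in> borel_measurable borel" and g[measurable]: "g \<in> borel_measurable borel"
    and h[measurable]: "h \<in> borel_measurable borel"
    and mid: "\<And>x y. f x * g y \<le> (h ((x + y) / 2))\<^sup>2"
    and sf: "(SUP x. f x) \<noteq> top" and sg: "(SUP x. g x) \<noteq> top"
  shows "(\<integral>\<^sup>+x. f x \<partial>lborel) * (\<integral>\<^sup>+x. g x \<partial>lborel) \<le> (\<integral>\<^sup>+x. h x \<partial>lborel)\<^sup>2"
proof (cases "(SUP x. f x) = 0 \<or> (SUP x. g x) = 0")
  case True
  then have "(\<forall>x. f x = 0) \<or> (\<forall>x. g x = 0)"
    by (metis SUP_upper UNIV_I le_zero_eq)
  then show ?thesis by auto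
next
  case False
  then obtain a b where ab: "(SUP x. f x) = ennreal a" "0 < a" "(SUP x. g x) = ennreal b" "0 < b"
    using sf sg by (metis ennreal_cases ennreal_0 order_le_less)
  \<comment> \<open>Dividing \<open>h\<close> by the geometric mean of the two suprema preserves the
    midpoint hypothesis when \<open>f\<close> and \<open>g\<close> are divided by \<open>a\<close>
    and \<open>b\<close>.\<close>
  define s where "s = sqrt (a * b)"
  have s: "0 < s" "s * s = a * b" using ab by (auto simp: s_def)
  have nz: "ennreal a \<noteq> 0" "ennreal b \<noteq> 0" "ennreal s \<noteq> 0" using ab s by auto
  have "(\<integral>\<^sup>+x. f x / ennreal a \<partial>lborel) + (\<integral>\<^sup>+x. g x / ennreal b \<partial>lborel) \<le> 2 * (\<integral>\<^sup>+x. h x / ennreal s \<partial>lborel)"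
  proof (rule prekopa_leindler_real_normalized)
    show "(SUP x. f x / ennreal a) = 1" "(SUP x. g x / ennreal b) = 1"
      using ab nz by (simp_all flip: SUP_divide_ennreal)
    fix x y
    have "f x / ennreal a * (g y / ennreal b) = f x * g y / (ennreal a * ennreal b)"
      using ab by (simp add: divide_ennreal_def ennreal_inverse_mult mult_ac)
    also have "ennreal a * ennreal b = ennreal s * ennreal s"
      using ab s by (simp flip: ennreal_mult)
    finally have "f x / ennreal a * (g y / ennreal b) = f x * g y / (ennreal s * ennreal s)" .
    also have "\<dots> \<le> (h ((x + y) / 2))\<^sup>2 / (ennreal s * ennreal s)"
      by (intro divide_right_mono_ennreal mid)
    also have "\<dots> = (h ((x + y) / 2) / ennreal s)\<^sup>2"
      using s by (simp add: divide_ennreal_def ennreal_inverse_mult power2_eq_square mult_ac)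
    finally show "f x / ennreal a * (g y / ennreal b) \<le> (h ((x + y) / 2) / ennreal s)\<^sup>2" .
  qed auto
  then have "(\<integral>\<^sup>+x. f x / ennreal a \<partial>lborel) * (\<integral>\<^sup>+x. g x / ennreal b \<partial>lborel) \<le> (\<integral>\<^sup>+x. h x / ennreal s \<partial>lborel)\<^sup>2"
    by (rule ennreal_am_gm)
  then have *: "(\<integral>\<^sup>+x. f x \<partial>lborel) / ennreal a * ((\<integral>\<^sup>+x. g x \<partial>lborel) / ennreal b) \<le> ((\<integral>\<^sup>+x. h x \<partial>lborel) / ennreal s)\<^sup>2"
    by (simp add: nn_integral_divide)
  have c: "u / ennreal c * ennreal c = u" if "0 < c" for u c
    using that by (metis ennreal_divide_times ennreal_divide_self ennreal_less_top ennreal_less_zero_iff mult.right_neutral less_irrefl)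
  from * have "(\<integral>\<^sup>+x. f x \<partial>lborel) / ennreal a * ((\<integral>\<^sup>+x. g x \<partial>lborel) / ennreal b) * (ennreal a * ennreal b)
     \<le> ((\<integral>\<^sup>+x. h x \<partial>lborel) / ennreal s)\<^sup>2 * (ennreal s * ennreal s)"
    using s ab by (simp add: mult_right_mono flip: ennreal_mult)
  then have "((\<integral>\<^sup>+x. f x \<partial>lborel) / ennreal a * ennreal a) * ((\<integral>\<^sup>+x. g x \<partial>lborel) / ennreal b * ennreal b)
     \<le> ((\<integral>\<^sup>+x. h x \<partial>lborel) / ennreal s * ennreal s)\<^sup>2"
    by (simp add: mult_ac power2_eq_square)
  then show ?thesis using c ab s by simp
qed

lemma nn_integral_SUP_min_of_nat:
  fixes f :: "'a \<Rightarrow> ennreal"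
  assumes [measurable]: "f \<in> borel_measurable M"
  shows "(SUP n. \<integral>\<^sup>+x. min (of_nat n) (f x) \<partial>M) = (\<integral>\<^sup>+x. f x \<partial>M)"
proof -
  have "(SUP n. min (of_nat n) y) = y" for y :: ennreal
  proof -
    have "(SUP n. min (of_nat n :: ennreal) y) = (SUP n. inf (of_nat n) y)" by (simp add: inf_min)
    also have "\<dots> = inf (SUP n. of_nat n) y" by (simp add: SUP_inf)
    also have "\<dots> = y" by (simp add: ennreal_SUP_of_nat_eq_top)
    finally show ?thesis .
  qed
  moreover have "(SUP n. \<integral>\<^sup>+x. min (of_nat n) (f x) \<partial>M) = (\<integral>\<^sup>+x. (SUP n. min (of_nat n) (f x)) \<partial>M)"
    by (intro nn_integral_monotone_convergence_SUP[symmetric])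
       (auto simp: incseq_def le_fun_def min_le_iff_disj intro: of_nat_mono)
  ultimately show ?thesis by simp
qed

text \<open>Truncating \<open>f\<close> and \<open>g\<close> at natural numbers only decreases the
  left side of the midpoint hypothesis. The bounded case then applies to the truncations, and
  monotone convergence removes them.\<close>

lemma prekopa_leindler_real:
  fixes f g h :: "real \<Rightarrow> ennreal"
  assumes f[measurable]: "f \<in> borel_measurable borel" and g[measurable]: "g \<in> borel_measurable borel"
    and h[measurable]: "h \<in> borel_measurable borel"
    and mid: "\<And>x y. f x * g y \<le> (h ((x + y) / 2))\<^sup>2"
  shows "(\<integral>\<^sup>+x. f x \<partial>lborel) * (\<integral>\<^sup>+x. g x \<partial>lborel) \<le> (\<integral>\<^sup>+x. h x \<partial>lborel)\<^sup>2"
proof -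
  have *: "(\<integral>\<^sup>+x. min (of_nat m) (f x) \<partial>lborel) * (\<integral>\<^sup>+x. min (of_nat n) (g x) \<partial>lborel) \<le> (\<integral>\<^sup>+x. h x \<partial>lborel)\<^sup>2" for m n
  proof (rule prekopa_leindler_real_bounded)
    show "min (of_nat m) (f x) * min (of_nat n) (g y) \<le> (h ((x + y) / 2))\<^sup>2" for x y
      by (rule order_trans[OF mult_mono mid]) auto
    have "(SUP x. min (of_nat k) (u x)) \<le> of_nat k" for k and u :: "real \<Rightarrow> ennreal"
      by (intro SUP_least) auto
    then show "(SUP x. min (of_nat m) (f x)) \<noteq> top" "(SUP x. min (of_nat n) (g x)) \<noteq> top"
      by (metis ennreal_of_nat_eq_real_of_nat ennreal_neq_top top_unique)+
  qed auto
  have "(SUP m. \<integral>\<^sup>+x. min (of_nat m) (f x) \<partial>lborel) * (SUP n. \<integral>\<^sup>+x. min (of_nat n) (g x) \<partial>lborel) \<le> (\<integral>\<^sup>+x. h x \<partial>lborel)\<^sup>2"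
    unfolding SUP_mult_left_ennreal SUP_mult_right_ennreal by (intro SUP_least *)
  then show ?thesis by (simp add: nn_integral_SUP_min_of_nat)
qed

section \<open>The Prekopa-Leindler inequality in finite dimension\<close>

text \<open>Induction on the number of coordinates: integrating out one coordinate with the
  one-dimensional inequality shows that the fibre integrals again satisfy the midpoint hypothesis.
  Points of the product space are extensional functions, hence the restricted midpoint.\<close>

lemma prekopa_leindler_PiM:
  fixes f g h :: "('i \<Rightarrow> real) \<Rightarrow> ennreal"
  assumes "finite I"
    and "f \<in> borel_measurable (PiM I (\<lambda>_. lborel))" "g \<in> borel_measurable (PiM I (\<lambda>_. lborel))"
      "h \<in> borel_measurable (PiM I (\<lambda>_. lborel))"
    and "\<And>x y. x \<in> extensional I \<Longrightarrow> y \<in> extensional I \<Longrightarrow>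
      f x * g y \<le> (h (\<lambda>i\<in>I. (x i + y i) / 2))\<^sup>2"
  shows "(\<integral>\<^sup>+x. f x \<partial>PiM I (\<lambda>_. lborel)) * (\<integral>\<^sup>+x. g x \<partial>PiM I (\<lambda>_. lborel)) \<le>
    (\<integral>\<^sup>+x. h x \<partial>PiM I (\<lambda>_. lborel))\<^sup>2"
  using assms
proof (induction I arbitrary: f g h rule: finite_induct)
  interpret product_sigma_finite "\<lambda>_::'i. lborel :: real measure" ..
  case empty
  show ?case
    using empty.prems(4)[of "\<lambda>_. undefined" "\<lambda>_. undefined"]
    by (simp add: nn_integral_empty restrict_def extensional_def)
next
  interpret product_sigma_finite "\<lambda>_::'i. lborel :: real measure" ..
  case (insert i I)
  note [measurable] = insert.prems(1-3)
  have upd[measurable]: "(\<lambda>(x, y). u (x(i := y))) \<in> borel_measurable (PiM I (\<lambda>_. lborel) \<Otimes>\<^sub>M lborel)"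
    if "u \<in> borel_measurable (PiM (insert i I) (\<lambda>_. lborel))" for u :: "('i \<Rightarrow> real) \<Rightarrow> ennreal"
    using measurable_compose[OF measurable_add_dim that] by (simp add: case_prod_beta')
  have sec: "(\<lambda>y. u (x(i := y))) \<in> borel_measurable borel"
    if "u \<in> borel_measurable (PiM (insert i I) (\<lambda>_. lborel))" "x \<in> extensional I"
    for u :: "('i \<Rightarrow> real) \<Rightarrow> ennreal" and x
    using measurable_Pair2[OF upd[OF that(1)], of x] that(2) by (simp add: space_PiM PiE_def)
  show ?case
    unfolding product_nn_integral_insert[OF insert.hyps insert.prems(1)]
      product_nn_integral_insert[OF insert.hyps insert.prems(2)]
      product_nn_integral_insert[OF insert.hyps insert.prems(3)]
  proof (rule insert.IH)
    fix x y :: "'i \<Rightarrow> real" assume xy: "x \<in> extensional I" "y \<in> extensional I"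
    let ?z = "\<lambda>i\<in>I. (x i + y i) / 2"
    have ext: "u(i := s) \<in> extensional (insert i I)" if "u \<in> extensional I" for u :: "'i \<Rightarrow> real" and s
      using that by (simp add: extensional_def)
    show "(\<integral>\<^sup>+s. f (x(i := s)) \<partial>lborel) * (\<integral>\<^sup>+s. g (y(i := s)) \<partial>lborel)
      \<le> (\<integral>\<^sup>+s. h (?z(i := s)) \<partial>lborel)\<^sup>2"
    proof (rule prekopa_leindler_real)
      fix s t
      \<comment> \<open>Taking midpoints commutes with splitting off coordinate
        \<open>i\<close>.\<close>
      have "(\<lambda>j\<in>insert i I. ((x(i := s)) j + (y(i := t)) j) / 2) = ?z(i := (s + t) / 2)"
        using insert.hyps by (auto simp: fun_eq_iff)
      then show "f (x(i := s)) * g (y(i := t)) \<le> (h (?z(i := (s + t) / 2)))\<^sup>2"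
        using insert.prems(4)[of "x(i := s)" "y(i := t)"] ext[OF xy(1)] ext[OF xy(2)] by metis
    qed (intro sec[OF insert.prems(1) xy(1)] sec[OF insert.prems(2) xy(2)] sec[OF insert.prems(3)] restrict_extensional)+
  qed (intro lborel.borel_measurable_nn_integral upd[OF insert.prems(1)] upd[OF insert.prems(2)]
      upd[OF insert.prems(3)])+
qed

theorem prekopa_leindler:
  fixes f g h :: "'a::euclidean_space \<Rightarrow> ennreal"
  assumes [measurable]: "f \<in> borel_measurable borel" "g \<in> borel_measurable borel" "h \<in> borel_measurable borel"
    and mid: "\<And>x y. f x * g y \<le> (h ((1/2) *\<^sub>R (x + y)))\<^sup>2"
  shows "(\<integral>\<^sup>+x. f x \<partial>lborel) * (\<integral>\<^sup>+x. g x \<partial>lborel) \<le> (\<integral>\<^sup>+x. h x \<partial>lborel)\<^sup>2"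
proof -
  let ?T = "\<lambda>x. \<Sum>b\<in>Basis. x b *\<^sub>R b :: 'a"
  have T[measurable]: "?T \<in> measurable (PiM Basis (\<lambda>_. lborel)) borel" by measurable
  have eq: "(\<integral>\<^sup>+x. u x \<partial>lborel) = (\<integral>\<^sup>+x. u (?T x) \<partial>PiM Basis (\<lambda>_. lborel))"
    if "u \<in> borel_measurable borel" for u :: "'a \<Rightarrow> ennreal"
    by (subst lborel_eq, subst nn_integral_distr) (use that in auto)
  show ?thesis
    unfolding eq[OF assms(1)] eq[OF assms(2)] eq[OF assms(3)]
  proof (rule prekopa_leindler_PiM)
    fix x y :: "'a \<Rightarrow> real"
    have "?T (\<lambda>i\<in>Basis. (x i + y i) / 2) = (1/2) *\<^sub>R (?T x + ?T y)"
      by (simp add: scaleR_right_distrib scaleR_sum_right scaleR_left_distrib sum.distrib add_divide_distrib)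
    then show "f (?T x) * g (?T y) \<le> (h (?T (\<lambda>i\<in>Basis. (x i + y i) / 2)))\<^sup>2"
      using mid by simp
  qed auto
qed

section \<open>Changes of variables and properties of geometric log-concave functions\<close>

lemma nn_integral_lborel_affine:
  fixes u :: "'a::euclidean_space \<Rightarrow> ennreal"
  assumes "u \<in> borel_measurable borel" "c \<noteq> 0"
  shows "(\<integral>\<^sup>+x. u x \<partial>lborel) = ennreal (\<bar>c\<bar> ^ DIM('a)) * (\<integral>\<^sup>+x. u (t + c *\<^sub>R x) \<partial>lborel)"
  by (subst lborel_affine[OF assms(2), of t])
     (use assms in \<open>simp add: nn_integral_density nn_integral_distr nn_integral_cmult\<close>)

lemma nn_integral_lborel_minus:
  fixes u :: "'a::euclidean_space \<Rightarrow> ennreal"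
  assumes "u \<in> borel_measurable borel"
  shows "(\<integral>\<^sup>+x. u (a - x) \<partial>lborel) = (\<integral>\<^sup>+x. u x \<partial>lborel)"
  using nn_integral_lborel_affine[OF assms, of "-1" a] by simp

lemma upper_semicontinuous_borel_measurable:
  assumes "upper_semicontinuous f"
  shows "f \<in> borel_measurable borel"
  unfolding borel_measurable_iff_less
proof
  fix c
  have "open {x. f x < c}"
    using assms by (subst open_subopen) (auto simp: upper_semicontinuous_def eventually_nhds subset_eq)
  then show "{x \<in> space borel. f x < c} \<in> sets borel" by simp
qed

lemma LC_gD:
  assumes "f \<in> LC_g"
  shows "f \<in> borel_measurable borel" "0 \<le> f x" "f x \<le> 1"
    "0 < (\<integral>\<^sup>+x. ennreal (f x) \<partial>lborel)" "(\<integral>\<^sup>+x. ennreal (f x) \<partial>lborel) < \<infinity>"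
  using assms upper_semicontinuous_borel_measurable by (auto simp: LC_g_def)

text \<open>Convexity of \<open>neg_log f\<close> with both weights 1/2, exponentiated. This is the
  only form in which log-concavity enters the covering bounds and the even case.\<close>

lemma LC_g_midpoint:
  assumes "f \<in> LC_g"
  shows "f x * f y \<le> (f ((1/2) *\<^sub>R (x + y)))\<^sup>2"
proof (cases "f x = 0 \<or> f y = 0")
  case False
  have pos: "0 < f x" "0 < f y" using False LC_gD(2)[OF assms] by (metis order_le_less)+
  let ?m = "(1/2) *\<^sub>R (x + y)"
  have "ereal_convex (neg_log f)" using assms by (simp add: LC_g_def)
  then have "neg_log f ((1/2) *\<^sub>R x + (1/2) *\<^sub>R y) \<le> ereal (1/2) * neg_log f x + ereal (1/2) * neg_log f y"
    unfolding ereal_convex_def by (elim allE[of _ x] allE[of _ y] allE[of _ "1/2"]) auto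
  then have le: "neg_log f ?m \<le> ereal (- (ln (f x) + ln (f y)) / 2)"
    using False by (simp add: neg_log_def scaleR_right_distrib diff_divide_distrib split: if_splits)
  \<comment> \<open>The bound on \<open>neg_log f ?m\<close> is finite, whereas
    \<open>neg_log\<close> is infinite at zeros of \<open>f\<close>.\<close>
  then have m: "0 < f ?m"
    using LC_gD(2)[OF assms, of ?m] by (auto simp: neg_log_def order_le_less split: if_splits)
  with le have "ln (f x) + ln (f y) \<le> 2 * ln (f ?m)"
    by (simp add: neg_log_def)
  then have "ln (f x * f y) \<le> ln ((f ?m)\<^sup>2)"
    using pos m by (simp add: ln_mult ln_realpow)
  then show ?thesis using pos m by (subst (asm) ln_le_cancel_iff) auto
qed auto

section \<open>Convolutions and the two bounds for the covering number\<close>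

lemma nn_integral_fconv:
  fixes f g :: "real ^ 'n \<Rightarrow> real"
  assumes [measurable]: "f \<in> borel_measurable borel" "g \<in> borel_measurable borel"
    and f: "\<And>x. 0 \<le> f x"
  shows "(\<integral>\<^sup>+x. fconv f g x \<partial>lborel) = (\<integral>\<^sup>+x. ennreal (f x) \<partial>lborel) * (\<integral>\<^sup>+x. ennreal (g x) \<partial>lborel)"
proof -
  have "(\<integral>\<^sup>+x. fconv f g x \<partial>lborel) = (\<integral>\<^sup>+t. (\<integral>\<^sup>+x. ennreal (f t * g (x - t)) \<partial>lborel) \<partial>lborel)"
    unfolding fconv_def by (rule lborel_pair.Fubini') simp
  also have "\<dots> = (\<integral>\<^sup>+t. ennreal (f t) * (\<integral>\<^sup>+x. ennreal (g (- t + 1 *\<^sub>R x)) \<partial>lborel) \<partial>lborel)"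
    using f by (simp add: ennreal_mult' nn_integral_cmult)
  also have "\<dots> = (\<integral>\<^sup>+t. ennreal (f t) * (\<integral>\<^sup>+x. ennreal (g x) \<partial>lborel) \<partial>lborel)"
  proof (intro nn_integral_cong)
    fix t
    have "(\<integral>\<^sup>+x. ennreal (g x) \<partial>lborel) = (\<integral>\<^sup>+x. ennreal (g (- t + 1 *\<^sub>R x)) \<partial>lborel)"
      using nn_integral_lborel_affine[of "\<lambda>x. ennreal (g x)" 1 "- t"] by simp
    then show "ennreal (f t) * (\<integral>\<^sup>+x. ennreal (g (- t + 1 *\<^sub>R x)) \<partial>lborel) =
        ennreal (f t) * (\<integral>\<^sup>+x. ennreal (g x) \<partial>lborel)" by simp
  qed
  finally show ?thesis by (simp add: nn_integral_multc)
qed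

text \<open>A vanishing convolution would have integral 0, but its integral is the product of two
  positive integrals; and \<open>g \<le> 1\<close> bounds the convolution by the integral of
  \<open>f\<close>. This justifies dividing by the supremum and cancelling it.\<close>

lemma sup_norm_fconv_pos_finite:
  fixes f g :: "real ^ 'n \<Rightarrow> real"
  assumes meas: "f \<in> borel_measurable borel" "g \<in> borel_measurable borel"
    and f: "\<And>x. 0 \<le> f x" and g: "\<And>x. g x \<le> 1"
    and "0 < (\<integral>\<^sup>+x. ennreal (f x) \<partial>lborel)" "(\<integral>\<^sup>+x. ennreal (f x) \<partial>lborel) < \<infinity>"
    and "0 < (\<integral>\<^sup>+x. ennreal (g x) \<partial>lborel)"
  shows "sup_norm (fconv f g) \<noteq> 0" "sup_norm (fconv f g) \<noteq> \<infinity>"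
proof
  assume "sup_norm (fconv f g) = 0"
  then have "fconv f g x = 0" for x
    unfolding sup_norm_def by (metis SUP_upper UNIV_I le_zero_eq)
  then show False using nn_integral_fconv[OF meas f] assms(5,7) by auto
next
  have "fconv f g x \<le> (\<integral>\<^sup>+x. ennreal (f x) \<partial>lborel)" for x
    unfolding fconv_def using mult_left_mono[OF g f] by (intro nn_integral_mono ennreal_leI) simp
  then have "sup_norm (fconv f g) \<le> (\<integral>\<^sup>+x. ennreal (f x) \<partial>lborel)"
    unfolding sup_norm_def by (rule SUP_least)
  then show "sup_norm (fconv f g) \<noteq> \<infinity>" using assms(6) by auto
qed

lemma covering_number_lower:
  fixes f g :: "real ^ 'n \<Rightarrow> real"
  assumes [measurable]: "f \<in> borel_measurable borel" "g \<in> borel_measurable borel"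
    and f: "\<And>x. 0 \<le> f x"
    and S: "sup_norm (fconv f (reflect g)) \<noteq> 0"
  shows "(\<integral>\<^sup>+x. ennreal ((f x)\<^sup>2) \<partial>lborel) / sup_norm (fconv f (reflect g)) \<le> covering_number f g"
  unfolding covering_number_def
proof (rule Inf_greatest, clarify)
  fix \<mu> :: "(real ^ 'n) measure"
  assume sets[measurable_cong]: "sets \<mu> = sets borel" and cover: "\<forall>x. ennreal (f x) \<le> mconv \<mu> g x"
  let ?S = "sup_norm (fconv f (reflect g))"
  have sp: "space \<mu> = UNIV" using sets_eq_imp_space_eq[OF sets] by simp
  show "(\<integral>\<^sup>+x. ennreal ((f x)\<^sup>2) \<partial>lborel) / ?S \<le> emeasure \<mu> UNIV"
  \<comment> \<open>Infinite mass makes the bound trivial; finite mass gives the sigma-finiteness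
    that Fubini requires.\<close>
  proof (cases "emeasure \<mu> UNIV = \<infinity>")
    case False
    then interpret finite_measure \<mu>
      by (intro finite_measureI) (simp add: sp)
    interpret pair_sigma_finite \<mu> lborel ..
    have "(\<integral>\<^sup>+x. ennreal ((f x)\<^sup>2) \<partial>lborel) \<le> (\<integral>\<^sup>+x. ennreal (f x) * mconv \<mu> g x \<partial>lborel)"
      using f cover by (intro nn_integral_mono) (simp add: power2_eq_square ennreal_mult mult_left_mono)
    also have "\<dots> = (\<integral>\<^sup>+x. (\<integral>\<^sup>+t. ennreal (f x * g (x - t)) \<partial>\<mu>) \<partial>lborel)"
      unfolding mconv_def using f by (simp add: nn_integral_cmult ennreal_mult')
    also have "\<dots> = (\<integral>\<^sup>+t. (\<integral>\<^sup>+x. ennreal (f x * g (x - t)) \<partial>lborel) \<partial>\<mu>)"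
      by (rule Fubini') simp
    also have "\<dots> = (\<integral>\<^sup>+t. fconv f (reflect g) t \<partial>\<mu>)"
      by (simp add: fconv_def reflect_def)
    also have "\<dots> \<le> (\<integral>\<^sup>+t. ?S \<partial>\<mu>)"
      unfolding sup_norm_def by (intro nn_integral_mono SUP_upper) simp
    also have "\<dots> = ?S * emeasure \<mu> UNIV" by (simp add: sp)
    finally show ?thesis
      using S by (intro divide_le_posI_ennreal) (auto simp: zero_less_iff_neq_zero)
  qed simp
qed

text \<open>The product form permits taking the supremum over \<open>a\<close> afterwards and covers
  points where the convolution vanishes.\<close>

lemma covering_number_mult_fconv_le:
  fixes f g :: "real ^ 'n \<Rightarrow> real"
  assumes meas[measurable]: "f \<in> borel_measurable borel" "g \<in> borel_measurable borel"
    and f: "\<And>x. 0 \<le> f x" and g: "\<And>x. 0 \<le> g x"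
    and mid: "\<And>x y. f x * f y \<le> (f ((1/2) *\<^sub>R (x + y)))\<^sup>2"
    and fin: "fconv f g a \<noteq> \<infinity>"
  shows "covering_number f g * fconv f g a \<le> 2 ^ CARD('n) * (\<integral>\<^sup>+x. ennreal ((f x)\<^sup>2) \<partial>lborel)"
proof (cases "fconv f g a = 0")
  case False
  let ?c = "fconv f g a"
  define k where "k t = ennreal ((f ((1/2) *\<^sub>R (t + a)))\<^sup>2)" for t
  have k[measurable]: "k \<in> borel_measurable borel" unfolding k_def by measurable
  define \<mu> where "\<mu> = density lborel (\<lambda>t. k t / ?c)"
  have "ennreal (f x) \<le> mconv \<mu> g x" for x
  proof -
    \<comment> \<open>Shifting \<open>t\<close> by \<open>a - x\<close> turns
      \<open>g (a - t)\<close> into \<open>g (x - t)\<close>, the kernel of \<open>mconv\<close>;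
      the factor from \<open>f\<close> becomes \<open>f (a - x + t)\<close>, whose argument has
      midpoint \<open>(t + a) / 2\<close> with \<open>x\<close>.\<close>
    have "(\<integral>\<^sup>+t. ennreal (f t * g (a - t)) \<partial>lborel) = (\<integral>\<^sup>+t. ennreal (f ((a - x) + 1 *\<^sub>R t) * g (a - ((a - x) + 1 *\<^sub>R t))) \<partial>lborel)"
      using nn_integral_lborel_affine[of "\<lambda>t. ennreal (f t * g (a - t))" 1 "a - x"] by simp
    then have "ennreal (f x) * ?c = (\<integral>\<^sup>+t. ennreal (f x) * ennreal (f (a - x + t) * g (x - t)) \<partial>lborel)"
      unfolding fconv_def by (subst nn_integral_cmult) auto
    also have "\<dots> \<le> (\<integral>\<^sup>+t. k t * ennreal (g (x - t)) \<partial>lborel)"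
    proof (rule nn_integral_mono)
      fix t
      have "f x * f (a - x + t) \<le> (f ((1/2) *\<^sub>R (t + a)))\<^sup>2"
        using mid[of x "a - x + t"] by (simp add: algebra_simps)
      then have "f x * f (a - x + t) * g (x - t) \<le> (f ((1/2) *\<^sub>R (t + a)))\<^sup>2 * g (x - t)"
        by (rule mult_right_mono) (rule g)
      then show "ennreal (f x) * ennreal (f (a - x + t) * g (x - t)) \<le> k t * ennreal (g (x - t))"
        using f g by (simp add: k_def ennreal_leI mult.assoc flip: ennreal_mult)
    qed
    finally have "ennreal (f x) * ?c / ?c \<le> (\<integral>\<^sup>+t. k t * ennreal (g (x - t)) \<partial>lborel) / ?c"
      by (rule divide_right_mono_ennreal)
    also have "\<dots> = mconv \<mu> g x"
      unfolding mconv_def \<mu>_def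
      by (simp add: nn_integral_density nn_integral_divide[symmetric] ennreal_times_divide mult.commute)
    finally show ?thesis using False fin by (simp add: ennreal_mult_divide_eq)
  qed
  then have "covering_number f g \<le> emeasure \<mu> UNIV"
    unfolding covering_number_def by (intro Inf_lower) (auto simp: \<mu>_def)
  also have "\<dots> = (\<integral>\<^sup>+t. k t \<partial>lborel) / ?c"
    by (simp add: \<mu>_def emeasure_density nn_integral_divide)
  \<comment> \<open>The substitution \<open>t = 2x - a\<close> turns \<open>k t\<close> into
    \<open>(f x)^2\<close>; its Jacobian is the constant 2^n of the theorem.\<close>
  also have "(\<integral>\<^sup>+t. k t \<partial>lborel) = 2 ^ CARD('n) * (\<integral>\<^sup>+x. ennreal ((f x)\<^sup>2) \<partial>lborel)"
    using nn_integral_lborel_affine[OF k, of 2 "- a"] by (simp add: k_def scaleR_right_distrib ennreal_power[symmetric])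
  finally have "covering_number f g * ?c \<le> 2 ^ CARD('n) * (\<integral>\<^sup>+x. ennreal ((f x)\<^sup>2) \<partial>lborel) / ?c * ?c"
    by (rule mult_right_mono) simp
  then show ?thesis using False fin by (simp add: ennreal_divide_times ennreal_divide_self top.not_eq_extremum)
qed simp

section \<open>The even case and the assembly of the bounds\<close>

lemma sup_norm_fconv_even:
  fixes f g :: "real ^ 'n \<Rightarrow> real"
  assumes f: "f \<in> LC_g" and g: "g \<in> LC_g" and ev: "even_fun f" "even_fun g"
  shows "sup_norm (fconv f g) = (\<integral>\<^sup>+x. ennreal (f x * g x) \<partial>lborel)"
proof -
  note [measurable] = LC_gD(1)[OF f] LC_gD(1)[OF g]
  note nn = LC_gD(2)[OF f] LC_gD(2)[OF g]
  have ev': "f (- x) = f x" "g (- x) = g x" for x using ev by (auto simp: even_fun_def)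
  have g_minus: "g (x - y) = g (y - x)" for x y using ev'(2)[of "x - y"] by simp
  have le: "fconv f g x \<le> fconv f g 0" for x
  proof -
    \<comment> \<open>Substituting \<open>-t\<close> for \<open>t\<close> and using that both
      functions are even shows that the convolution is even.\<close>
    have "fconv f g (- x) = (\<integral>\<^sup>+t. ennreal (f (0 - t) * g (- x - (0 - t))) \<partial>lborel)"
      unfolding fconv_def by (rule nn_integral_lborel_minus[symmetric]) simp
    also have "\<dots> = fconv f g x"
      unfolding fconv_def by (intro nn_integral_cong) (simp add: ev' g_minus[of x])
    finally have "(fconv f g x)\<^sup>2 = fconv f g x * fconv f g (- x)" by (simp add: power2_eq_square)
    \<comment> \<open>Prekopa-Leindler for the integrands at \<open>x\<close>, \<open>-x\<close> and
      \<open>0\<close>: the arguments \<open>x - s\<close> and \<open>- x - t\<close> of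
      \<open>g\<close> have midpoint \<open>-(s + t)/2\<close>, from which \<open>x\<close> has
      cancelled.\<close>
    also have "\<dots> \<le> (fconv f g 0)\<^sup>2"
      unfolding fconv_def
    proof (rule prekopa_leindler)
      fix s t
      have "f s * f t * (g (x - s) * g (- x - t)) \<le>
        (f ((1/2) *\<^sub>R (s + t)))\<^sup>2 * (g ((1/2) *\<^sub>R ((x - s) + (- x - t))))\<^sup>2"
        using nn by (intro mult_mono LC_g_midpoint f g) auto
      also have "(1/2) *\<^sub>R ((x - s) + (- x - t)) = 0 - (1/2) *\<^sub>R (s + t)"
        by (simp add: algebra_simps)
      finally have "f s * g (x - s) * (f t * g (- x - t)) \<le>
          (f ((1/2) *\<^sub>R (s + t)) * g (0 - (1/2) *\<^sub>R (s + t)))\<^sup>2"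
        by (simp add: power_mult_distrib mult_ac)
      then show "ennreal (f s * g (x - s)) * ennreal (f t * g (- x - t)) \<le>
          (ennreal (f ((1/2) *\<^sub>R (s + t)) * g (0 - (1/2) *\<^sub>R (s + t))))\<^sup>2"
        using nn by (simp add: ennreal_leI ennreal_power flip: ennreal_mult)
    qed simp_all
    finally have "\<not> fconv f g 0 < fconv f g x"
      using ennreal_mult_strict_mono[of "fconv f g 0" "fconv f g x" "fconv f g 0" "fconv f g x"]
      by (auto simp: power2_eq_square)
    then show ?thesis by simp
  qed
  have "sup_norm (fconv f g) = fconv f g 0"
    unfolding sup_norm_def using le by (intro antisym SUP_least SUP_upper) auto
  then show ?thesis by (simp add: fconv_def ev')
qed

theorem theorem4p3:
  fixes f g :: "real ^ 'n \<Rightarrow> real"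
  assumes "f \<in> LC_g" and "g \<in> LC_g"
  shows "((\<integral>\<^sup>+x. ennreal ((f x)\<^sup>2) \<partial>lborel) / sup_norm (fconv f (reflect g)) \<le> covering_number f g \<and>
          covering_number f g \<le>
            2 ^ CARD('n) * ((\<integral>\<^sup>+x. ennreal ((f x)\<^sup>2) \<partial>lborel) / sup_norm (fconv f g))) \<and>
         (even_fun f \<and> even_fun g \<longrightarrow>
            (\<integral>\<^sup>+x. ennreal ((f x)\<^sup>2) \<partial>lborel) / (\<integral>\<^sup>+x. ennreal (f x * g x) \<partial>lborel)
              \<le> covering_number f g \<and>
            covering_number f g \<le>
              2 ^ CARD('n) * ((\<integral>\<^sup>+x. ennreal ((f x)\<^sup>2) \<partial>lborel) /
                              (\<integral>\<^sup>+x. ennreal (f x * g x) \<partial>lborel)))"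
proof -
  note meas[measurable] = LC_gD(1)[OF assms(1)] LC_gD(1)[OF assms(2)]
  note f = LC_gD[OF assms(1)]
  note g = LC_gD[OF assms(2)]
  let ?I = "\<integral>\<^sup>+x. ennreal ((f x)\<^sup>2) \<partial>lborel"
  have "(\<integral>\<^sup>+x. ennreal (reflect g x) \<partial>lborel) = (\<integral>\<^sup>+x. ennreal (g x) \<partial>lborel)"
    using nn_integral_lborel_minus[of "\<lambda>x. ennreal (g x)" 0] by (simp add: reflect_def)
  moreover have "reflect g \<in> borel_measurable borel" "reflect g x \<le> 1" for x
    unfolding reflect_def using g(3) by auto
  ultimately have "sup_norm (fconv f (reflect g)) \<noteq> 0"
    using f g(4) by (intro sup_norm_fconv_pos_finite) auto
  then have lower: "?I / sup_norm (fconv f (reflect g)) \<le> covering_number f g"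
    using f by (intro covering_number_lower meas) auto
  let ?S = "sup_norm (fconv f g)"
  have S: "?S \<noteq> 0" "?S \<noteq> \<infinity>"
    using sup_norm_fconv_pos_finite[of f g] f g by auto
  have "fconv f g a \<noteq> \<infinity>" for a
    using S(2) SUP_upper[of a UNIV "fconv f g"] by (metis UNIV_I infinity_ennreal_def sup_norm_def top_unique)
  \<comment> \<open>The supremum over the centre \<open>a\<close> moves outside the product, so the
    bound for each single \<open>a\<close> suffices.\<close>
  then have "covering_number f g * ?S \<le> 2 ^ CARD('n) * ?I"
    unfolding sup_norm_def SUP_mult_left_ennreal
    using f g by (intro SUP_least covering_number_mult_fconv_le LC_g_midpoint assms meas) auto
  then have "covering_number f g * ?S / ?S \<le> 2 ^ CARD('n) * ?I / ?S"
    by (rule divide_right_mono_ennreal)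
  then have upper: "covering_number f g \<le> 2 ^ CARD('n) * (?I / ?S)"
    using S by (simp add: ennreal_mult_divide_eq ennreal_times_divide)
  \<comment> \<open>For even \<open>g\<close> the two supremum norms coincide, so one evaluation of
    the norm serves both bounds.\<close>
  have "reflect g = g" if "even_fun g"
    using that by (auto simp: reflect_def even_fun_def)
  then show ?thesis
    using lower upper sup_norm_fconv_even[OF assms] by auto
qed

end
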